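(* Let $n\ge1$ and let $q:\mathbb{R}^n_x\times\mathbb{R}^n_\xi\to\mathbb{C}$ be a complex-valued quadratic form which is elliptic on its singular space $S$, i.e. $$(x,\xi)\in S,\ q(x,\xi)=0\ \Rightarrow\ (x,\xi)=0.$$ Then $S$ has a symplectic structure, i.e. the restriction of the canonical symplectic form $\sigma$ to $S$ is nondegenerate.
   Context: The canonical symplectic form on $\mathbb{R}^{2n}$ is $\sigma((x,\xi),(y,\eta))=\xi\cdot y-x\cdot\eta$. The Hamilton map of $q$ is the matrix $F\in M_{2n}(\mathbb{C})$ uniquely defined by $q(X;Y)=\sigma(X,FY)$ for $X,Y\in\mathbb{R}^{2n}$, where $q(\cdot;\cdot)$ is the symmetric bilinear (polarized) form of $q$. $\operatorname{Re}F$ and $\operatorname{Im}F$ are the entrywise real and imaginary parts. The singular space of $q$ is $$S=\Big(\bigcap_{j=0}^{2n-1}\operatorname{Ker}\big[\operatorname{Re}F(\operatorname{Im}F)^j\big]\Big)\cap\mathbb{R}^{2n}$$ (equivalently, the intersection over all $j\ge0$). The zero space is regarded as symplectic. *)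

theory Defs
  imports "HOL-Analysis.Analysis"
begin

text \<open>
  A vector of phase space, of type \<open>'a ^ ('n + 'n)\<close> with \<open>n = CARD('n)\<close>, is a pair \<open>(x, \<xi>)\<close>:
  the entries indexed by \<open>Inl\<close> are those of \<open>x\<close> and the entries indexed by \<open>Inr\<close> are those
  of \<open>\<xi>\<close>. A \<open>2n \<times> 2n\<close> matrix thus acts on phase space by \<open>*v\<close>.
\<close>

definition complex_quadratic_form :: "('v::real_vector \<Rightarrow> complex) \<Rightarrow> bool" where
  "complex_quadratic_form q \<longleftrightarrow>
     (\<exists>B. bilinear B \<and> (\<forall>X Y. B X Y = B Y X) \<and> (\<forall>X. q X = B X X))"

definition polar_form :: "('v::real_vector \<Rightarrow> complex) \<Rightarrow> 'v \<Rightarrow> 'v \<Rightarrow> complex" where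
  "polar_form q X Y = (q (X + Y) - q X - q Y) / 2"

text \<open>
  The form \<open>\<sigma>((x,\<xi>),(y,\<eta>)) = \<xi> \<cdot> y - x \<cdot> \<eta>\<close>. Over the complex numbers this is the
  complex-bilinear (not sesquilinear) extension of the real form; the inner product of the
  library would not give that.
\<close>

definition symplectic_form :: "'a::comm_ring_1 ^ ('n::finite + 'n) \<Rightarrow> 'a ^ ('n + 'n) \<Rightarrow> 'a" where
  "symplectic_form X Y =
     (\<Sum>i\<in>UNIV. X $ Inr i * Y $ Inl i) - (\<Sum>i\<in>UNIV. X $ Inl i * Y $ Inr i)"

definition complex_vec :: "real ^ 'm \<Rightarrow> complex ^ 'm" where
  "complex_vec X = (\<chi> i. complex_of_real (X $ i))"

text \<open>
  The description is proper for every quadratic form, see \<open>hamilton_map_unique\<close> below.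
\<close>

definition hamilton_map ::
  "(real ^ ('n::finite + 'n) \<Rightarrow> complex) \<Rightarrow> complex ^ ('n + 'n) ^ ('n + 'n)" where
  "hamilton_map q =
     (THE F. \<forall>X Y. polar_form q X Y = symplectic_form (complex_vec X) (F *v complex_vec Y))"

text \<open>
  The operations \<open>*\<close> and \<open>^\<close> of the type of matrices are entrywise, hence this definition.
\<close>

definition matrix_power :: "'a::comm_ring_1 ^ 'm ^ 'm::finite \<Rightarrow> nat \<Rightarrow> 'a ^ 'm ^ 'm" where
  "matrix_power A k = (((**) A) ^^ k) (mat 1)"

definition singular_space ::
  "(real ^ ('n::finite + 'n) \<Rightarrow> complex) \<Rightarrow> (real ^ ('n + 'n)) set" where
  "singular_space q =
     (\<Inter>j\<in>{0..2 * CARD('n) - 1}.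
        {X. (map_matrix Re (hamilton_map q) **
             matrix_power (map_matrix Im (hamilton_map q)) j) *v X = 0})"

definition elliptic_on :: "('v::zero \<Rightarrow> complex) \<Rightarrow> 'v set \<Rightarrow> bool" where
  "elliptic_on q V \<longleftrightarrow> (\<forall>X\<in>V. q X = 0 \<longrightarrow> X = 0)"

definition symplectic_subspace :: "(real ^ ('n::finite + 'n)) set \<Rightarrow> bool" where
  "symplectic_subspace V \<longleftrightarrow>
     subspace V \<and> (\<forall>X\<in>V. (\<forall>Y\<in>V. symplectic_form X Y = 0) \<longrightarrow> X = 0)"


lemma polar_form_eq:
  assumes "bilinear B" "\<forall>X Y. B X Y = B Y X" "\<forall>X. q X = B X X"
  shows "polar_form q X Y = B X Y"
proof -
  have "B (X + Y) (X + Y) = B X X + B Y Y + (B X Y + B Y X)"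
    by (simp add: bilinear_ladd[OF assms(1)] bilinear_radd[OF assms(1)])
  then have "q (X + Y) - q X - q Y = 2 * B X Y"
    using assms(2,3) by simp
  then show ?thesis by (simp add: polar_form_def)
qed

lemma complex_vec_axis: "complex_vec (axis k 1) = axis k 1"
  by (simp add: complex_vec_def axis_def vec_eq_iff)

lemma symplectic_form_axis:
  fixes Z :: "complex ^ ('n::finite + 'n)"
  shows "symplectic_form (axis (Inl a) 1) Z = - (Z $ Inr a)"
    and "symplectic_form (axis (Inr a) 1) Z = Z $ Inl a"
  by (simp_all add: symplectic_form_def axis_def if_distrib if_distribR cong: if_cong)

lemma vec_axis_expansion: "(X :: real ^ 'm) = (\<Sum>i\<in>UNIV. X $ i *\<^sub>R axis i 1)"
  using basis_expansion[of X] by (simp add: scalar_mult_eq_scaleR)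

lemma hamilton_map_unique:
  fixes q :: "real ^ ('n::finite + 'n) \<Rightarrow> complex"
  assumes "complex_quadratic_form q"
  shows "\<exists>!F. \<forall>X Y. polar_form q X Y = symplectic_form (complex_vec X) (F *v complex_vec Y)"
proof -
  obtain B where B: "bilinear B" "\<forall>X Y. B X Y = B Y X" "\<forall>X. q X = B X X"
    using assms unfolding complex_quadratic_form_def by blast
  have pol: "polar_form q X Y = B X Y" for X Y
    by (rule polar_form_eq[OF B])
  define F :: "complex ^ ('n + 'n) ^ ('n + 'n)" where
    "F = (\<chi> i j. case i of Inl a \<Rightarrow> B (axis (Inr a) 1) (axis j 1)
                         | Inr a \<Rightarrow> - B (axis (Inl a) 1) (axis j 1))"
  have lin1: "linear (\<lambda>X. B X Y)" and lin2: "linear (B X)" for X Y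
    using B(1) by (auto simp: bilinear_def)
  have expand: "B X Y = (\<Sum>i\<in>UNIV. of_real (X $ i) *
      (\<Sum>j\<in>UNIV. of_real (Y $ j) * B (axis i 1) (axis j 1)))" for X Y
  proof -
    have "B X Y = (\<Sum>i\<in>UNIV. X $ i *\<^sub>R B (axis i 1) Y)"
      by (subst vec_axis_expansion[of X]) (simp add: linear_sum[OF lin1] linear_scale[OF lin1])
    moreover have "B (axis i 1) Y = (\<Sum>j\<in>UNIV. Y $ j *\<^sub>R B (axis i 1) (axis j 1))" for i
      by (subst vec_axis_expansion[of Y]) (simp add: linear_sum[OF lin2] linear_scale[OF lin2])
    ultimately show ?thesis by (simp add: scaleR_conv_of_real)
  qed
  have "\<forall>X Y. B X Y = symplectic_form (complex_vec X) (F *v complex_vec Y)"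
  proof (intro allI)
    fix X Y
    let ?h = "\<lambda>i. of_real (X $ i) * (\<Sum>j\<in>UNIV. of_real (Y $ j) * B (axis i 1) (axis j 1))"
    have "B X Y = (\<Sum>i\<in>UNIV. ?h (Inl i)) + (\<Sum>i\<in>UNIV. ?h (Inr i))"
      unfolding expand[of X Y] by (subst UNIV_Plus_UNIV[symmetric], subst sum.Plus) simp_all
    also have "\<dots> = symplectic_form (complex_vec X) (F *v complex_vec Y)"
      by (simp add: symplectic_form_def complex_vec_def F_def matrix_vector_mult_def
          sum_negf mult.commute)
    finally show "B X Y = symplectic_form (complex_vec X) (F *v complex_vec Y)" .
  qed
  moreover have "G = H"
    if "\<forall>X Y. B X Y = symplectic_form (complex_vec X) (G *v complex_vec Y)"
       "\<forall>X Y. B X Y = symplectic_form (complex_vec X) (H *v complex_vec Y)"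
     for G H :: "complex ^ ('n + 'n) ^ ('n + 'n)"
  proof -
    have eq: "symplectic_form (axis k 1) (G *v axis j 1) = symplectic_form (axis k 1) (H *v axis j 1)"
      for k j :: "'n + 'n"
      using that by (metis complex_vec_axis)
    have entries: "(G *v axis j 1) $ i = (H *v axis j 1) $ i" for i j
    proof (cases i)
      case (Inl a)
      then show ?thesis using eq[of "Inr a" j] by (simp add: symplectic_form_axis)
    next
      case (Inr a)
      then show ?thesis using eq[of "Inl a" j] by (simp add: symplectic_form_axis)
    qed
    have "G $ i $ j = H $ i $ j" for i j
      using entries[of j i]
      by (simp add: matrix_vector_mult_def axis_def if_distrib cong: if_cong)
    then show "G = H"
      by (simp add: vec_eq_iff)
  qed
  ultimately show ?thesis unfolding pol by blast
qed

end

theory Submission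
  imports Defs
begin

text \<open>
  Write \<open>F = A + \<i> B\<close> with real \<open>A\<close>, \<open>B\<close>. The singular space \<open>S\<close> lies in the kernel of \<open>A\<close>
  and is invariant under \<open>B\<close>, so \<open>q(X) = \<i> \<sigma>(X, B X)\<close> for \<open>X \<in> S\<close>. If \<open>X \<in> S\<close> is
  \<open>\<sigma>\<close>-orthogonal to \<open>S\<close>, it is orthogonal to \<open>B X \<in> S\<close>; hence \<open>q(X) = 0\<close>, and \<open>X = 0\<close>
  by ellipticity.
\<close>

text \<open>Replaces Cayley-Hamilton by counting dimensions: among \<open>DIM('v) + 1\<close>
  iterates one must depend on its predecessors, and all later iterates stay in the span of
  these.\<close>

lemma funpow_in_span_lower_funpows:
  fixes f :: "'v::euclidean_space \<Rightarrow> 'v"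
  assumes "linear f"
  shows "(f ^^ DIM('v)) x \<in> span ((\<lambda>j. (f ^^ j) x) ` {..<DIM('v)})"
proof -
  define W where "W k = (\<lambda>j. (f ^^ j) x) ` {..<k}" for k
  have W_Suc: "W (Suc k) = insert ((f ^^ k) x) (W k)" for k
    by (auto simp: W_def lessThan_Suc)
  have "\<exists>k\<le>DIM('v). (f ^^ k) x \<in> span (W k)"
  proof (rule ccontr)
    assume "\<not> ?thesis"
    then have new: "(f ^^ k) x \<notin> span (W k)" if "k \<le> DIM('v)" for k
      using that by blast
    \<comment> \<open>Each new iterate raises the dimension by one, so the iterates up to index
      \<open>DIM('v)\<close> would span too large a space.\<close>
    have "k \<le> Suc DIM('v) \<Longrightarrow> dim (W k) = k" for k
      by (induction k) (simp_all add: W_Suc dim_insert new, simp add: W_def)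
    from this[of "Suc DIM('v)"] show False
      using dim_subset_UNIV[of "W (Suc DIM('v))"] by simp
  qed
  then obtain k where k: "k \<le> DIM('v)" "(f ^^ k) x \<in> span (W k)"
    by blast
  \<comment> \<open>\<open>f\<close> shifts the generators by one index; the only possible newcomer
    is \<open>(f ^^ k) x\<close>, in the span by the choice of \<open>k\<close>.\<close>
  have invariant: "f y \<in> span (W k)" if "y \<in> span (W k)" for y
  proof -
    have "f ` W k \<subseteq> W (Suc k)"
      by (force simp: W_def intro: image_eqI[where x = "Suc _"])
    also have "\<dots> \<subseteq> span (W k)"
      using k(2) by (auto simp: W_Suc intro: span_base)
    finally have "span (f ` W k) \<subseteq> span (W k)"
      by (simp add: span_minimal)
    then show ?thesis
      using that by (auto simp: linear_span_image[OF assms])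
  qed
  have "(f ^^ (k + m)) x \<in> span (W k)" for m
    by (induction m) (simp_all add: k(2) invariant)
  from this[of "DIM('v) - k"] have "(f ^^ DIM('v)) x \<in> span (W k)"
    using k(1) by simp
  moreover have "span (W k) \<subseteq> span (W DIM('v))"
    using k(1) by (intro span_mono) (auto simp: W_def)
  ultimately show ?thesis
    by (auto simp: W_def)
qed

lemma matrix_power_mult_vec:
  "matrix_power A k *v X = (((*v) A) ^^ k) X"
  by (induction k) (simp_all add: matrix_power_def flip: matrix_vector_mul_assoc)

text \<open>Real and imaginary parts separate because \<open>X\<close> and \<open>Y\<close> are
  real.\<close>

lemma complex_symplectic_form_mult_vec:
  fixes F :: "complex ^ ('n::finite + 'n) ^ ('n + 'n)"
  shows "symplectic_form (complex_vec X) (F *v complex_vec Y) =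
    Complex (symplectic_form X (map_matrix Re F *v Y)) (symplectic_form X (map_matrix Im F *v Y))"
  by (simp add: complex_eq_iff symplectic_form_def complex_vec_def matrix_vector_mult_def
      map_matrix_def)

lemma quadratic_form_hamilton_map:
  fixes q :: "real ^ ('n::finite + 'n) \<Rightarrow> complex"
  assumes "complex_quadratic_form q"
  shows "q X = Complex (symplectic_form X (map_matrix Re (hamilton_map q) *v X))
                       (symplectic_form X (map_matrix Im (hamilton_map q) *v X))"
proof -
  have "polar_form q X X = symplectic_form (complex_vec X) (hamilton_map q *v complex_vec X)"
    using theI'[OF hamilton_map_unique[OF assms]] unfolding hamilton_map_def by blast
  moreover have "polar_form q X X = q X"
    using assms unfolding complex_quadratic_form_def by (metis polar_form_eq)
  ultimately show ?thesis
    by (simp add: complex_symplectic_form_mult_vec)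
qed

lemma in_singular_space_iff:
  fixes q :: "real ^ ('n::finite + 'n) \<Rightarrow> complex"
  shows "X \<in> singular_space q \<longleftrightarrow> (\<forall>j<2 * CARD('n).
    map_matrix Re (hamilton_map q) *v (((*v) (map_matrix Im (hamilton_map q)) ^^ j) X) = 0)"
proof -
  \<comment> \<open>Truncated subtraction is harmless here, as \<open>CARD('n)\<close> is
    positive.\<close>
  have "{0..2 * CARD('n) - 1} = {..<2 * CARD('n)}"
    using zero_less_card_finite[where 'a = 'n] by (auto simp del: zero_less_card_finite)
  then show ?thesis
    by (auto simp: singular_space_def matrix_power_mult_vec simp flip: matrix_vector_mul_assoc)
qed

lemma subspace_singular_space: "subspace (singular_space q)"
  unfolding singular_space_def
  by (intro subspace_Inter) (auto intro!: linear_subspace_kernel)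

text \<open>Applying \<open>Im F\<close> once more shifts the exponents to 1, ..., 2n. Only 2n lies
  beyond the definition, and that iterate is a combination of lower ones, all killed by
  \<open>Re F\<close>.\<close>

lemma singular_space_invariant:
  fixes q :: "real ^ ('n::finite + 'n) \<Rightarrow> complex"
  assumes "X \<in> singular_space q"
  shows "map_matrix Im (hamilton_map q) *v X \<in> singular_space q"
proof -
  let ?A = "map_matrix Re (hamilton_map q)" and ?B = "(*v) (map_matrix Im (hamilton_map q))"
  let ?N = "2 * CARD('n)"
  have low: "?A *v ((?B ^^ j) X) = 0" if "j < ?N" for j
    using assms that by (simp add: in_singular_space_iff)
  have dim: "DIM(real ^ ('n + 'n)) = ?N"
    by simp
  have "(?B ^^ ?N) X \<in> span ((\<lambda>j. (?B ^^ j) X) ` {..<?N})"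
    using funpow_in_span_lower_funpows[of ?B X] unfolding dim by simp
  also have "\<dots> \<subseteq> {Y. ?A *v Y = 0}"
    using low by (intro span_minimal linear_subspace_kernel) auto
  finally have "?A *v ((?B ^^ j) X) = 0" if "j \<le> ?N" for j
    using that low by (cases "j = ?N") auto
  from this[of "Suc _"] show ?thesis
    by (simp add: in_singular_space_iff funpow_swap1)
qed

theorem mainTheorem4:
  fixes q :: "real ^ ('n::finite + 'n) \<Rightarrow> complex"
  assumes "complex_quadratic_form q"
    and "elliptic_on q (singular_space q)"
  shows "symplectic_subspace (singular_space q)"
  unfolding symplectic_subspace_def
proof (intro conjI ballI impI)
  show "subspace (singular_space q)"
    by (rule subspace_singular_space)
next
  fix X
  assume X: "X \<in> singular_space q" and orth: "\<forall>Y\<in>singular_space q. symplectic_form X Y = 0"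
  \<comment> \<open>This is the condition for exponent 0, which is in range since 2n is
    positive.\<close>
  have "map_matrix Re (hamilton_map q) *v X = 0"
    using X zero_less_card_finite[where 'a = 'n]
    by (auto simp: in_singular_space_iff dest: spec[of _ 0])
  moreover have "symplectic_form X (map_matrix Im (hamilton_map q) *v X) = 0"
    using orth singular_space_invariant[OF X] by blast
  ultimately have "q X = 0"
    by (simp add: quadratic_form_hamilton_map[OF assms(1)] symplectic_form_def zero_complex.code)
  then show "X = 0"
    using assms(2) X by (auto simp: elliptic_on_def)
qed

end
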